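(* If a $(v,k,\lambda)$-BIBD admits a $0$-ULSE $\ell$-colouring, then \[v=\frac{\ell(\ell-2)k}{(\ell-1)^2-k}.\]
   Context: For positive integers $v,k,\lambda$ with $2\le k<v$, a $(v,k,\lambda)$-BIBD is a pair $(V,\mathcal{B})$ where $V$ is a set of $v$ points and $\mathcal{B}$ is a collection of $k$-element subsets of $V$ (blocks) such that every pair of distinct points lies in exactly $\lambda$ blocks. An $\ell$-colouring is a surjective map from $V$ onto a set of $\ell$ colours. A $0$-ULSE $\ell$-colouring is an $\ell$-colouring such that $(\ell-1)$ divides $k$ and in every block exactly one colour does not appear, while each of the other $\ell-1$ colours appears exactly $\frac{k}{\ell-1}$ times in that block. *)

theory Defs
  imports Complex_Main "HOL-Library.Multiset"
begin

text \<open>The collection of blocks is a multiset, so repeated blocks are allowed and counted with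
  multiplicity.\<close>

definition bibd :: "nat \<Rightarrow> nat \<Rightarrow> nat \<Rightarrow> 'a set \<Rightarrow> 'a set multiset \<Rightarrow> bool" where
  "bibd v k lam V \<B> \<longleftrightarrow>
     0 < lam \<and> 2 \<le> k \<and> k < v \<and>
     finite V \<and> card V = v \<and>
     (\<forall>B \<in># \<B>. B \<subseteq> V \<and> card B = k) \<and>
     (\<forall>x\<in>V. \<forall>y\<in>V. x \<noteq> y \<longrightarrow> size {#B \<in># \<B>. x \<in> B \<and> y \<in> B#} = lam)"

definition colouring :: "nat \<Rightarrow> 'a set \<Rightarrow> 'c set \<Rightarrow> ('a \<Rightarrow> 'c) \<Rightarrow> bool" where
  "colouring l V C f \<longleftrightarrow> finite C \<and> card C = l \<and> f ` V = C"

text \<open>For a colouring of a nonempty \<open>V\<close> we have \<open>l \<ge> 1\<close>, so the subtraction \<open>l - 1\<close> on the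
  natural numbers does not truncate, and the division \<open>k div (l - 1)\<close> is exact by the
  divisibility condition.\<close>

definition zero_ulse_colouring ::
  "nat \<Rightarrow> nat \<Rightarrow> 'a set \<Rightarrow> 'a set multiset \<Rightarrow> 'c set \<Rightarrow> ('a \<Rightarrow> 'c) \<Rightarrow> bool" where
  "zero_ulse_colouring l k V \<B> C f \<longleftrightarrow>
     colouring l V C f \<and> (l - 1) dvd k \<and>
     (\<forall>B \<in># \<B>.
        (\<exists>!c. c \<in> C \<and> c \<notin> f ` B) \<and>
        (\<forall>c \<in> C. c \<in> f ` B \<longrightarrow> card {x \<in> B. f x = c} = k div (l - 1)))"

end

theory Submission imports Defs begin

text \<open>Fix a point \<open>x\<close> lying in \<open>r\<close> blocks and put \<open>m = k / (l - 1)\<close>. Counting the incidences of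
  the blocks through \<open>x\<close> with the other points gives \<open>r (k - 1) = lam (v - 1)\<close>, and counting only
  the points with the colour of \<open>x\<close> gives \<open>r (m - 1) = lam (n - 1)\<close>, where \<open>n\<close> is the size of the
  colour class. Hence \<open>(v - 1) (m - 1) = (n - 1) (k - 1)\<close>, so all colour classes have the same size
  \<open>n = v / l\<close>, and the equation can be solved for \<open>v\<close>.\<close>

lemma sum_mset_card_Int:
  assumes "finite T"
  shows "(\<Sum>B\<in>#M. card (B \<inter> T)) = (\<Sum>y\<in>T. size {#B \<in># M. y \<in> B#})"
proof (induction M)
  case (add B M)
  have "card (B \<inter> T) = (\<Sum>y\<in>T. if y \<in> B then 1 else 0)"
    using assms by (simp add: sum.If_cases Int_commute)
  moreover have "(\<Sum>y\<in>T. size {#B' \<in># add_mset B M. y \<in> B'#})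
      = (\<Sum>y\<in>T. (if y \<in> B then 1 else 0) + size {#B' \<in># M. y \<in> B'#})"
    by (intro sum.cong) auto
  ultimately show ?case
    using add.IH by (simp add: sum.distrib)
qed simp

text \<open>Double count pairs \<open>(B, y)\<close> with \<open>x\<close>, \<open>y\<close> in
  \<open>B\<close> and \<open>y\<close> in \<open>S - {x}\<close>: each block through
  \<open>x\<close> gives \<open>s - 1\<close> of them, each \<open>y\<close> gives
  \<open>lam\<close>. Leaving \<open>S\<close> general covers both all of \<open>V\<close> and a
  single colour class.\<close>

lemma bibd_replication_Int:
  assumes "bibd v k lam V \<B>" and "S \<subseteq> V" and "x \<in> S"
    and meet: "\<And>B. B \<in># \<B> \<Longrightarrow> x \<in> B \<Longrightarrow> card (B \<inter> S) = s"
  shows "size {#B \<in># \<B>. x \<in> B#} * (s - 1) = lam * (card S - 1)"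
proof -
  let ?M = "{#B \<in># \<B>. x \<in> B#}" and ?T = "S - {x}"
  have fin: "finite S"
    using assms(1,2) by (auto simp: bibd_def intro: finite_subset)
  have "card (B \<inter> ?T) = s - 1" if "B \<in># ?M" for B
  proof -
    have "B \<inter> ?T = B \<inter> S - {x}" by auto
    then show ?thesis using that meet[of B] \<open>x \<in> S\<close> by simp
  qed
  then have "(\<Sum>B\<in>#?M. card (B \<inter> ?T)) = (\<Sum>B\<in>#?M. s - 1)"
    by (intro arg_cong[where f = sum_mset] image_mset_cong)
  then have "size ?M * (s - 1) = (\<Sum>y\<in>?T. size {#B \<in># ?M. y \<in> B#})"
    using fin by (simp add: sum_mset_card_Int)
  also have "\<dots> = (\<Sum>y\<in>?T. lam)"
  proof (intro sum.cong refl)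
    fix y assume "y \<in> ?T"
    then have "x \<in> V" "y \<in> V" "x \<noteq> y"
      using assms(2,3) by auto
    then have "size {#B \<in># \<B>. x \<in> B \<and> y \<in> B#} = lam"
      using assms(1) by (simp add: bibd_def)
    then show "size {#B \<in># ?M. y \<in> B#} = lam"
      by (simp add: filter_filter_mset conj_commute)
  qed
  also have "\<dots> = lam * (card S - 1)"
    using fin \<open>x \<in> S\<close> by simp
  finally show ?thesis .
qed

lemma zero_ulse_colour_class_size:
  assumes bibd: "bibd v k lam V \<B>" and ulse: "zero_ulse_colouring l k V \<B> C f" and "c \<in> C"
  shows "(v - 1) * (k div (l - 1) - 1) = (card {x \<in> V. f x = c} - 1) * (k - 1)"
proof -
  let ?S = "{x \<in> V. f x = c}" and ?m = "k div (l - 1)"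
  obtain x where x: "x \<in> ?S"
    using ulse \<open>c \<in> C\<close> by (auto simp: zero_ulse_colouring_def colouring_def)
  let ?r = "size {#B \<in># \<B>. x \<in> B#}"
  have blocks: "B \<subseteq> V" "card B = k" if "B \<in># \<B>" for B
    using bibd that by (auto simp: bibd_def)
  have "?r * (k - 1) = lam * (card V - 1)"
    using x blocks by (intro bibd_replication_Int[OF bibd]) (auto simp: Int_absorb2)
  then have all: "?r * (k - 1) = lam * (v - 1)"
    using bibd by (simp add: bibd_def)
  have "card (B \<inter> ?S) = ?m" if "B \<in># \<B>" "x \<in> B" for B
  proof -
    have "B \<inter> ?S = {y \<in> B. f y = c}" using blocks(1)[OF that(1)] by auto
    \<comment> \<open>The point \<open>x\<close> shows that \<open>c\<close> is not the colour
      missing from \<open>B\<close>.\<close>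
    moreover have "c \<in> f ` B" using x that(2) by auto
    ultimately show ?thesis
      using ulse that(1) \<open>c \<in> C\<close> by (auto simp: zero_ulse_colouring_def)
  qed
  then have "?r * (?m - 1) = lam * (card ?S - 1)"
    using x by (intro bibd_replication_Int[OF bibd]) auto
  \<comment> \<open>Both sides equal \<open>?r * (k - 1) * (?m - 1)\<close>; this eliminates
    \<open>?r\<close>, and \<open>lam > 0\<close> then cancels.\<close>
  then have "lam * ((v - 1) * (?m - 1)) = lam * ((card ?S - 1) * (k - 1))"
    using all by (metis mult.assoc mult.commute)
  then show ?thesis
    using bibd by (simp add: bibd_def)
qed

theorem theorem3p5:
  fixes v k lam l :: nat
    and V :: "'a set" and \<B> :: "'a set multiset"
    and C :: "'c set" and f :: "'a \<Rightarrow> 'c"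
  assumes "bibd v k lam V \<B>"
    and "zero_ulse_colouring l k V \<B> C f"
  shows "real v = real l * (real l - 2) * real k / ((real l - 1)\<^sup>2 - real k)"
proof -
  have k: "2 \<le> k" "k < v" and V: "finite V" "card V = v"
    using assms(1) by (auto simp: bibd_def)
  have C: "finite C" "card C = l" "f ` V = C" and dvd: "(l - 1) dvd k"
    using assms(2) by (auto simp: zero_ulse_colouring_def colouring_def)
  define m where "m = k div (l - 1)"
  have km: "k = (l - 1) * m"
    using dvd by (simp add: m_def)
  with k have l: "2 \<le> l" and m: "1 \<le> m"
    by (cases "l - 1"; cases m; simp)+
  let ?n = "\<lambda>c. card {x \<in> V. f x = c}"
  have class_size: "(real v - 1) * (real m - 1) = (real (?n c) - 1) * (real k - 1)" if "c \<in> C" for c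
  proof -
    \<comment> \<open>Surjectivity makes every class nonempty, so \<open>?n c - 1\<close> does not
      truncate and the identity passes to the reals.\<close>
    have "{x \<in> V. f x = c} \<noteq> {}" using that C(3) by auto
    then have "1 \<le> ?n c" using V(1) by (simp add: Suc_le_eq card_gt_0_iff)
    then show ?thesis
      using arg_cong[OF zero_ulse_colour_class_size[OF assms that], of real] k m
      by (simp add: m_def of_nat_diff)
  qed
  have "v = card (\<Union>c\<in>C. {x \<in> V. f x = c})"
    using V(2) C(3) by (intro trans[OF V(2)[symmetric]] arg_cong[where f = card]) auto
  also have "\<dots> = (\<Sum>c\<in>C. ?n c)"
    using V(1) C(1) by (intro card_UN_disjoint) auto
  finally have v: "real v = (\<Sum>c\<in>C. real (?n c))"
    by simp
  \<comment> \<open>Summing over all colours replaces the class sizes by their total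
    \<open>v\<close>.\<close>
  have "real l * ((real v - 1) * (real m - 1)) = (\<Sum>c\<in>C. (real (?n c) - 1) * (real k - 1))"
    using C(2) class_size by (simp flip: class_size)
  also have "\<dots> = (real v - real l) * (real k - 1)"
    using C(2) by (simp add: v sum_subtractf flip: sum_distrib_right)
  finally have eq: "real l * ((real v - 1) * (real m - 1)) = (real v - real l) * (real k - 1)" .
  have rkm: "real k = (real l - 1) * real m"
    using km l by (simp add: of_nat_diff)
  \<comment> \<open>The factor \<open>l - 1\<close> turns \<open>m - 1\<close> into
    \<open>k - (l - 1)\<close>, which removes \<open>m\<close>.\<close>
  have "(real l - 1) * (real l * ((real v - 1) * (real m - 1)))
      = real l * (real v - 1) * (real k - (real l - 1))"
    by (simp add: rkm algebra_simps)
  then have sol: "real v * ((real l - 1)\<^sup>2 - real k) = real l * (real l - 2) * real k"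
    unfolding eq by (simp add: algebra_simps power2_eq_square)
  \<comment> \<open>A zero denominator would force \<open>l * (l - 2) * k = 0\<close> by
    \<open>sol\<close>, so \<open>l = 2\<close> and hence \<open>k = 1\<close>, against
    \<open>2 \<le> k\<close>.\<close>
  have "(real l - 1)\<^sup>2 - real k \<noteq> 0"
  proof
    assume 0: "(real l - 1)\<^sup>2 - real k = 0"
    with sol k l have "l = 2" by auto
    with 0 k show False by simp
  qed
  with sol show ?thesis by (simp add: field_simps)
qed

end
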